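(* Let $n \geq 1$, let $\mathcal{X} \subset \mathbb{R}^n$ be a nonempty bounded set, and let $f_s : \mathbb{R}^n \rightarrow \mathbb{R}$ be Lipschitz-continuous over $\mathcal{X}$ and separable over $\mathcal{X}$, i.e., there exist functions $f_{u,1}, \ldots, f_{u,n} : \mathbb{R} \rightarrow \mathbb{R}$ such that $$f_s(x) = \sum_{j=1}^{n} f_{u,j}(x_j) \quad \text{for all } x = (x_1, \ldots, x_n) \in \mathcal{X} .$$ Then for every $\epsilon > 0$ there exists a piecewise-concave function $p : \mathbb{R}^n \rightarrow \mathbb{R}$ such that $$\sup_{x \in \mathcal{X}} | f_s(x) - p(x) | \leq \epsilon .$$
   Context: A function $p : \mathbb{R}^n \rightarrow \mathbb{R}$ is called piecewise-concave if it is the pointwise maximum of finitely many concave functions, i.e., there exist a positive integer $n_p$ and concave functions $p_1, \ldots, p_{n_p} : \mathbb{R}^n \rightarrow \mathbb{R}$ such that $p(x) = \max_{i=1,\ldots,n_p} p_i(x)$ for all $x \in \mathbb{R}^n$. Lipschitz continuity of $f_s$ over $\mathcal{X}$ means that there is a constant $\kappa > 0$ with $|f_s(x) - f_s(y)| \leq \kappa \|x - y\|_2$ for all $x, y \in \mathcal{X}$. *)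

theory Defs
  imports "HOL-Analysis.Analysis"
begin

definition piecewise_concave :: "(real ^ 'n \<Rightarrow> real) \<Rightarrow> bool" where
  "piecewise_concave p \<longleftrightarrow>
     (\<exists>(m::nat) (q :: nat \<Rightarrow> real ^ 'n \<Rightarrow> real).
        m \<ge> 1 \<and> (\<forall>i\<in>{1..m}. concave_on UNIV (q i)) \<and>
        (\<forall>x. p x = (MAX i\<in>{1..m}. q i x)))"

definition separable_over :: "(real ^ 'n) set \<Rightarrow> (real ^ 'n \<Rightarrow> real) \<Rightarrow> bool" where
  "separable_over X f \<longleftrightarrow>
     (\<exists>u :: 'n \<Rightarrow> real \<Rightarrow> real. \<forall>x\<in>X. f x = (\<Sum>j\<in>UNIV. u j (x $ j)))"

end

theory Submission
  imports Defs
begin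

text \<open>
  If \<open>f\<close> is \<open>\<kappa>\<close>-Lipschitz on \<open>X\<close>, then each downward cone \<open>x \<mapsto> f a - \<kappa> * dist a x\<close> with apex on
  the graph of \<open>f\<close> over \<open>a \<in> X\<close> is concave and stays below \<open>f\<close> on \<open>X\<close>.  The same Lipschitz bound,
  read in the other direction, shows that it lies at most \<open>2 * \<kappa> * dist a x\<close> below \<open>f x\<close>.  A bounded
  set has a finite net of mesh \<open>\<epsilon> / (2 * \<kappa>)\<close> (\<open>bounded_imp_finite_net\<close>), so at every point of
  \<open>X\<close> one of finitely many cones is within \<open>\<epsilon>\<close> of \<open>f\<close> while none exceeds it.  The maximum of
  these cones is the approximation sought (\<open>lipschitz_on_cone_approximation\<close>); it is the lower
  McShane extension of \<open>f\<close> restricted to the net.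
\<close>

lemma piecewise_concave_Max:
  fixes q :: "'a \<Rightarrow> real ^ 'n \<Rightarrow> real"
  assumes "finite A" "A \<noteq> {}" and concave: "\<And>a. a \<in> A \<Longrightarrow> concave_on UNIV (q a)"
  shows "piecewise_concave (\<lambda>x. MAX a\<in>A. q a x)"
proof -
  obtain h where h: "bij_betw h {1..card A} A"
    using ex_bij_betw_nat_finite_1[OF \<open>finite A\<close>] by blast
  then have img: "h ` {1..card A} = A"
    by (simp add: bij_betw_def)
  have "card A \<ge> 1"
    using \<open>finite A\<close> \<open>A \<noteq> {}\<close> by (simp add: Suc_le_eq card_gt_0_iff)
  moreover have "\<forall>i\<in>{1..card A}. concave_on UNIV (q (h i))"
    using img concave by blast
  moreover have "\<forall>x. (MAX a\<in>A. q a x) = (MAX i\<in>{1..card A}. q (h i) x)"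
  proof
    fix x
    have "(\<lambda>a. q a x) ` A = (\<lambda>i. q (h i) x) ` {1..card A}"
      by (subst img[symmetric]) (rule image_image)
    then show "(MAX a\<in>A. q a x) = (MAX i\<in>{1..card A}. q (h i) x)"
      by (rule arg_cong)
  qed
  ultimately show ?thesis
    unfolding piecewise_concave_def
    by (intro exI[of _ "card A"] exI[of _ "\<lambda>i. q (h i)"] conjI)
qed

lemma concave_on_downward_cone:
  fixes a :: "'a :: real_normed_vector"
  assumes "\<kappa> \<ge> 0" "convex S"
  shows "concave_on S (\<lambda>x. c - \<kappa> * dist a x)"
proof -
  have "convex_on S (\<lambda>x. \<kappa> * dist a x + - c)"
    using assms by (intro convex_on_add convex_on_cmul convex_on_dist
        convex_on_const[THEN iffD2])
  then show ?thesis
    by (simp add: concave_on_def)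
qed

text \<open>
  The cover by balls is extracted from the compact closure, but the balls are centred in \<open>X\<close>
  itself, because the values of \<open>f\<close> are controlled only there.
\<close>
lemma bounded_imp_finite_net:
  fixes X :: "'a :: heine_borel set"
  assumes "bounded X" "r > 0"
  obtains A where "finite A" "A \<subseteq> X" "X \<subseteq> (\<Union>a\<in>A. ball a r)"
proof -
  have cover: "closure X \<subseteq> (\<Union>a\<in>X. ball a r)"
    using \<open>r > 0\<close> by (auto simp: closure_approachable)
  have "compact (closure X)"
    using \<open>bounded X\<close> by simp
  then obtain A where A: "A \<subseteq> X" "finite A" "closure X \<subseteq> (\<Union>a\<in>A. ball a r)"
    by (rule compactE_image[OF _ open_ball cover])
  show ?thesis
    by (rule that[OF A(2,1) order_trans[OF closure_subset A(3)]])
qed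

text \<open>
  Moving from \<open>x\<close> to the nearby net point \<open>b\<close> costs \<open>\<kappa> * r\<close> twice: once because \<open>f b\<close> may lie
  below \<open>f x\<close>, and once because the cone at \<open>b\<close> has descended from its apex by the time it
  reaches \<open>x\<close>.
\<close>
lemma lipschitz_on_cone_approximation:
  fixes f :: "'a :: metric_space \<Rightarrow> real"
  assumes lip: "\<kappa>-lipschitz_on X f" and "finite A" "A \<subseteq> X"
    and net: "X \<subseteq> (\<Union>a\<in>A. ball a r)" and "x \<in> X"
  shows "\<bar>f x - (MAX a\<in>A. f a - \<kappa> * dist a x)\<bar> \<le> 2 * \<kappa> * r"
proof -
  have bound: "\<bar>f a - f x\<bar> \<le> \<kappa> * dist a x" if "a \<in> A" for a
    using lipschitz_onD[OF lip, of a x] that \<open>A \<subseteq> X\<close> \<open>x \<in> X\<close> by (auto simp: dist_real_def)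
  obtain b where b: "b \<in> A" "dist b x < r"
    using net \<open>x \<in> X\<close> by auto
  have "(MAX a\<in>A. f a - \<kappa> * dist a x) \<le> f x"
  proof (rule Max.boundedI)
    fix y assume "y \<in> (\<lambda>a. f a - \<kappa> * dist a x) ` A"
    then obtain a where "a \<in> A" "y = f a - \<kappa> * dist a x"
      by blast
    then show "y \<le> f x"
      using bound[of a] by linarith
  qed (use \<open>finite A\<close> b in auto)
  moreover have "f b - \<kappa> * dist b x \<le> (MAX a\<in>A. f a - \<kappa> * dist a x)"
    using \<open>finite A\<close> b by (intro Max_ge) auto
  moreover have "\<kappa> * dist b x \<le> \<kappa> * r"
    using b lipschitz_on_nonneg[OF lip] by (intro mult_left_mono) auto
  ultimately show ?thesis
    using bound[OF b(1)] by linarith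
qed

theorem corollary1:
  fixes X :: "(real ^ 'n) set" and f :: "real ^ 'n \<Rightarrow> real" and \<epsilon> :: real
  assumes "X \<noteq> {}" and "bounded X"
    and "\<exists>\<kappa>>0. \<kappa>-lipschitz_on X f"
    and "separable_over X f"
    and "\<epsilon> > 0"
  shows "\<exists>p :: real ^ 'n \<Rightarrow> real. piecewise_concave p \<and>
           bdd_above ((\<lambda>x. \<bar>f x - p x\<bar>) ` X) \<and> (SUP x\<in>X. \<bar>f x - p x\<bar>) \<le> \<epsilon>"
proof -
  obtain \<kappa> where "\<kappa> > 0" and lip: "\<kappa>-lipschitz_on X f"
    using assms by blast
  obtain A where A: "finite A" "A \<subseteq> X" "X \<subseteq> (\<Union>a\<in>A. ball a (\<epsilon> / (2 * \<kappa>)))"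
    using bounded_imp_finite_net[OF \<open>bounded X\<close>, of "\<epsilon> / (2 * \<kappa>)"] \<open>\<epsilon> > 0\<close> \<open>\<kappa> > 0\<close> by auto
  with \<open>X \<noteq> {}\<close> have "A \<noteq> {}"
    by auto
  define p where "p x = (MAX a\<in>A. f a - \<kappa> * dist a x)" for x
  have "piecewise_concave p"
    unfolding p_def using A \<open>A \<noteq> {}\<close> \<open>\<kappa> > 0\<close>
    by (intro piecewise_concave_Max concave_on_downward_cone) auto
  moreover have approx: "\<bar>f x - p x\<bar> \<le> \<epsilon>" if "x \<in> X" for x
    using lipschitz_on_cone_approximation[OF lip A that] \<open>\<kappa> > 0\<close> by (simp add: p_def)
  moreover have "bdd_above ((\<lambda>x. \<bar>f x - p x\<bar>) ` X)"
    using approx by (intro bdd_aboveI2)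
  moreover have "(SUP x\<in>X. \<bar>f x - p x\<bar>) \<le> \<epsilon>"
    using approx \<open>X \<noteq> {}\<close> by (intro cSUP_least)
  ultimately show ?thesis
    by blast
qed

end
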